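(* Let $U(z)=\sum_{j\in E}u_jz^j\in\mathcal{L}$ with $u_j\in\mathcal{L}_\downarrow$. Suppose that $u_i\ne0$ is invertible in $\mathcal{L}_\downarrow(\ell_1)$ for some $i\in E\setminus\{0\}$. Let $\rho_U(F)=\rho(U\,\overline{F})$ for $F\in\mathcal{L}(\ell_1)$. Then: (i) the elements $H_{|j-i|}=\overline{u_j}\,z^i-\overline{u_i}\,z^j$, $j\in E\setminus\{i\}$, form a basis of $\operatorname{Ker}\rho_U$ over $\mathcal{L}_\downarrow(\ell_1)$; (ii) if $H\in\mathcal{L}$ is a polynomial such that $\rho_U(H)$ is invertible in $\mathcal{L}_\downarrow(\ell_1)$, then the polynomials $\{H_j:j\in E\setminus\{0\}\}$ together with $H$ form a basis of $\mathcal{L}(\ell_1)$ over $\mathcal{L}_\downarrow(\ell_1)$.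
   Context: Let $d\ge1$, $E=\{0,1\}^d$, $\mathbb{T}^d=\{z\in\mathbb{C}^d:|z_j|=1\}$, $z^k=z_1^{k_1}\cdots z_d^{k_d}$ for $k\in\mathbb{Z}^d$. $\mathcal{L}$ is the ring of Laurent polynomials $\sum_{k\in M}a_kz^k$ ($M\subset\mathbb{Z}^d$ finite, $a_k\in\mathbb{C}$), and $\mathcal{L}(\ell_1)$ is the commutative ring of Laurent series $\sum_{k\in\mathbb{Z}^d}a_kz^k$ with $a\in\ell_1(\mathbb{Z}^d)$, considered as functions on $\mathbb{T}^d$. Subrings: $\mathcal{L}_\downarrow=\{P(z^2):P\in\mathcal{L}\}$ and $\mathcal{L}_\downarrow(\ell_1)=\{F(z^2):F\in\mathcal{L}(\ell_1)\}$, where $z^2=(z_1^2,\dots,z_d^2)$. $\mathcal{L}(\ell_1)$ is a free $\mathcal{L}_\downarrow(\ell_1)$-module with basis $z^j$, $j\in E$. Conjugation: $\overline{\sum a_kz^k}=\sum\overline{a_k}z^{-k}$. The map $\rho:\mathcal{L}(\ell_1)\to\mathcal{L}_\downarrow(\ell_1)$ sends $A=\sum_{j\in E}a_jz^j$ (unique $a_j\in\mathcal{L}_\downarrow(\ell_1)$) to $a_0$. $\operatorname{Ker}\rho_U=\{F\in\mathcal{L}(\ell_1):\rho_U(F)=0\}$. For $i=(i_1,\dots,i_d)\in\mathbb{Z}^d$, $|i|:=(|i_1|,\dots,|i_d|)$; for fixed $i\in E$ the map $j\mapsto|j-i|$ is a bijection of $E\setminus\{i\}$ onto $E\setminus\{0\}$,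 so $H_s$ is defined for every $s\in E\setminus\{0\}$. *)

theory Defs
  imports "HOL-Analysis.Analysis" "HOL-Library.Function_Algebras"
begin

text \<open>
  The dimension \<open>d \<ge> 1\<close> is the cardinality of the index type \<open>'d::finite\<close>.  Functions on the torus
  carry the pointwise ring structure of \<^theory>\<open>HOL-Library.Function_Algebras\<close>, so \<open>+\<close>, \<open>*\<close>, \<open>0\<close>, \<open>1\<close>
  and finite sums below are the operations of the ring of functions on the torus.
\<close>

typedef (overloaded) 'd torus = "{z :: complex ^ ('d::finite). \<forall>j. norm (z $ j) = 1}"
  by (rule exI[of _ "\<chi> j. 1"]) simp

definition torus_sq :: "('d::finite) torus \<Rightarrow> 'd torus" where
  "torus_sq z = Abs_torus (\<chi> j. (Rep_torus z $ j)\<^sup>2)"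

definition zpow :: "int ^ ('d::finite) \<Rightarrow> 'd torus \<Rightarrow> complex" where
  "zpow k = (\<lambda>z. \<Prod>j\<in>UNIV. (Rep_torus z $ j) powi (k $ j))"

definition cube :: "(int ^ ('d::finite)) set" where
  "cube = {k. \<forall>j. k $ j = 0 \<or> k $ j = 1}"

definition vabs :: "int ^ ('d::finite) \<Rightarrow> int ^ 'd" where
  "vabs k = (\<chi> j. \<bar>k $ j\<bar>)"

definition laurent_poly :: "(('d::finite) torus \<Rightarrow> complex) set" where
  "laurent_poly = {P. \<exists>M a. finite M \<and> P = (\<lambda>z. \<Sum>k\<in>M. a k * zpow k z)}"

definition ell1 :: "(int ^ ('d::finite) \<Rightarrow> complex) set" where
  "ell1 = {a. (\<lambda>k. norm (a k)) summable_on UNIV}"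

definition laurent_l1 :: "(('d::finite) torus \<Rightarrow> complex) set" where
  "laurent_l1 = {F. \<exists>a\<in>ell1. F = (\<lambda>z. \<Sum>\<^sub>\<infinity>k. a k * zpow k z)}"

definition laurent_poly_down :: "(('d::finite) torus \<Rightarrow> complex) set" where
  "laurent_poly_down = {P \<circ> torus_sq | P. P \<in> laurent_poly}"

definition laurent_l1_down :: "(('d::finite) torus \<Rightarrow> complex) set" where
  "laurent_l1_down = {F \<circ> torus_sq | F. F \<in> laurent_l1}"

text \<open>
  Conjugation is defined on the Laurent expansion.  It does not depend on the chosen expansion,
  because on the torus the result is the pointwise complex conjugate.
\<close>

definition laurent_conj :: "(('d::finite) torus \<Rightarrow> complex) \<Rightarrow> 'd torus \<Rightarrow> complex" where
  "laurent_conj F = (THE G. \<exists>a\<in>ell1. F = (\<lambda>z. \<Sum>\<^sub>\<infinity>k. a k * zpow k z) \<and>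
     G = (\<lambda>z. \<Sum>\<^sub>\<infinity>k. cnj (a k) * zpow (- k) z))"

definition rho :: "(('d::finite) torus \<Rightarrow> complex) \<Rightarrow> 'd torus \<Rightarrow> complex" where
  "rho A = (THE a0. \<exists>a. (\<forall>j\<in>cube. a j \<in> laurent_l1_down) \<and>
     A = (\<Sum>j\<in>cube. a j * zpow j) \<and> a0 = a 0)"

definition rho_U :: "(('d::finite) torus \<Rightarrow> complex) \<Rightarrow> ('d torus \<Rightarrow> complex) \<Rightarrow> 'd torus \<Rightarrow> complex" where
  "rho_U U F = rho (U * laurent_conj F)"

definition Ker_rho_U :: "(('d::finite) torus \<Rightarrow> complex) \<Rightarrow> ('d torus \<Rightarrow> complex) set" where
  "Ker_rho_U U = {F \<in> laurent_l1. rho_U U F = 0}"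

definition invertible_in :: "'a::comm_ring_1 set \<Rightarrow> 'a \<Rightarrow> bool" where
  "invertible_in R x \<longleftrightarrow> x \<in> R \<and> (\<exists>y\<in>R. x * y = 1)"

text \<open>
  The family \<open>b\<close> indexed by the finite set \<open>I\<close> is a basis of \<open>M\<close> over the subring \<open>R\<close>: it is linearly
  independent over \<open>R\<close>, and \<open>M\<close> is exactly its \<open>R\<close>-span.
\<close>

definition basis_over :: "'a::comm_ring_1 set \<Rightarrow> 'a set \<Rightarrow> 'i set \<Rightarrow> ('i \<Rightarrow> 'a) \<Rightarrow> bool" where
  "basis_over R M I b \<longleftrightarrow> finite I \<and>
     (\<forall>c. (\<forall>j\<in>I. c j \<in> R) \<longrightarrow> (\<Sum>j\<in>I. c j * b j) = 0 \<longrightarrow> (\<forall>j\<in>I. c j = 0)) \<and>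
     M = {\<Sum>j\<in>I. c j * b j | c. \<forall>j\<in>I. c j \<in> R}"

lemma bij_betw_vabs_cube:
  fixes i :: "int ^ ('d::finite)"
  assumes "i \<in> cube"
  shows "bij_betw (\<lambda>j. vabs (j - i)) (cube - {i}) (cube - {0})"
proof (rule bij_betwI[where g = "\<lambda>s. vabs (s - i)"])
  have i: "i $ n = 0 \<or> i $ n = 1" for n
    using assms by (simp add: cube_def)
  have invol: "vabs (vabs (j - i) - i) = j" if "j \<in> cube" for j
  proof -
    have "j $ n = 0 \<or> j $ n = 1" for n
      using that by (simp add: cube_def)
    then have "\<bar>\<bar>j $ n - i $ n\<bar> - i $ n\<bar> = j $ n" for n
      using i[of n] by (smt (verit))
    then show ?thesis
      by (simp add: vabs_def vec_eq_iff)
  qed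
  have cube: "vabs (j - i) \<in> cube" if "j \<in> cube" for j
  proof -
    have "j $ n = 0 \<or> j $ n = 1" for n
      using that by (simp add: cube_def)
    then have "\<bar>j $ n - i $ n\<bar> = 0 \<or> \<bar>j $ n - i $ n\<bar> = 1" for n
      using i[of n] by (smt (verit))
    then show ?thesis
      by (simp add: vabs_def cube_def)
  qed
  have zero: "vabs (- i) = i" "vabs 0 = 0"
    using i by (auto simp: vabs_def vec_eq_iff) (smt (verit))
  show "(\<lambda>j. vabs (j - i)) \<in> cube - {i} \<rightarrow> cube - {0}"
    using cube invol zero by (force simp: Pi_iff)
  show "(\<lambda>s. vabs (s - i)) \<in> cube - {0} \<rightarrow> cube - {i}"
    using cube invol zero by (force simp: Pi_iff)
qed (use assms in \<open>auto simp: vabs_def vec_eq_iff cube_def\<close>, (smt (verit))+)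

text \<open>
  \<open>H_gen i u s\<close> is \<open>H\<^sub>s\<close> for \<open>s \<in> cube - {0}\<close>: the index \<open>j\<close> is recovered from \<open>s = |j - i|\<close> by the
  bijection above.  The value at \<open>s = 0\<close> carries no meaning, so this slot can be overwritten to
  adjoin a further element to the family.
\<close>

definition H_gen :: "int ^ ('d::finite) \<Rightarrow> (int ^ 'd \<Rightarrow> 'd torus \<Rightarrow> complex) \<Rightarrow> int ^ 'd \<Rightarrow> 'd torus \<Rightarrow> complex" where
  "H_gen i u s = (let j = the_inv_into (cube - {i}) (\<lambda>j. vabs (j - i)) s in
     laurent_conj (u j) * zpow i - laurent_conj (u i) * zpow j)"

lemma H_gen_vabs:
  assumes "i \<in> cube" "j \<in> cube - {i}"
  shows "H_gen i u (vabs (j - i)) = laurent_conj (u j) * zpow i - laurent_conj (u i) * zpow j"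
  using the_inv_into_f_f[OF bij_betw_imp_inj_on[OF bij_betw_vabs_cube[OF assms(1)]] assms(2)]
  by (simp add: H_gen_def)

end

theory Submission imports Defs begin

text \<open>
  Averaging a function on the torus over all sign changes \<open>z\<^sub>n \<mapsto> \<plusminus> z\<^sub>n\<close> fixes every monomial with
  even exponents and kills all the others, so this average computes \<open>\<rho>\<close>.  Writing
  \<open>F = \<Sum>\<^sub>j f\<^sub>j z\<^sup>j\<close>, orthogonality of the monomials \<open>z\<^sup>j\<close>, \<open>j \<in> {0,1}\<^sup>d\<close>, under the average gives
  that \<open>\<rho>\<^sub>U(F)\<close> is the conjugate of \<open>\<Sum>\<^sub>j v\<^sub>j f\<^sub>j\<close>, where \<open>v\<^sub>j\<close> is the conjugate of \<open>u\<^sub>j\<close>.  Hence the kernel is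
  a hyperplane in a free module whose equation has the invertible coefficient \<open>v\<^sub>i\<close>, and such a
  hyperplane is free on the vectors \<open>v\<^sub>j z\<^sup>i - v\<^sub>i z\<^sup>j\<close>.  For (ii), \<open>\<rho>\<^sub>U\<close> is conjugate-linear, so an \<open>H\<close>
  with \<open>\<rho>\<^sub>U(H)\<close> invertible spans a complement of the kernel.
\<close>

section \<open>Monomials on the torus, the cube of exponents, and pointwise conjugation\<close>

lemma sum_fun_apply: "(\<Sum>i\<in>I. f i) x = (\<Sum>i\<in>I. f i x)"
  by (induction I rule: infinite_finite_induct) simp_all

lemma norm_Rep_torus [simp]: "norm (Rep_torus z $ n) = 1"
  using Rep_torus[of z] by simp

lemma Rep_torus_nonzero [simp]: "Rep_torus z $ n \<noteq> 0"
  using norm_Rep_torus[of z n] by force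

lemma cnj_Rep_torus: "cnj (Rep_torus z $ n) = inverse (Rep_torus z $ n)"
  by (metis complex_norm_square inverse_unique norm_Rep_torus of_real_1 power_one)

lemma Rep_torus_sq: "Rep_torus (torus_sq z) $ n = (Rep_torus z $ n)\<^sup>2"
  by (simp add: torus_sq_def Abs_torus_inverse norm_power)

lemma norm_zpow [simp]: "norm (zpow k z) = 1"
  by (simp add: zpow_def norm_power_int flip: prod_norm)

lemma zpow_0 [simp]: "zpow 0 = 1"
  by (simp add: zpow_def fun_eq_iff)

lemma zpow_add: "zpow (k + l) z = zpow k z * zpow l z"
  by (simp add: zpow_def power_int_add prod.distrib)

lemma zpow_mult: "zpow k * zpow l = zpow (k + l)"
  by (simp add: zpow_add fun_eq_iff)

lemma cnj_zpow: "cnj (zpow k z) = zpow (- k) z"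
  by (simp add: zpow_def cnj_Rep_torus power_int_minus power_int_inverse)

lemma zpow_torus_sq: "zpow k (torus_sq z) = zpow (k + k) z"
  unfolding zpow_add by (simp add: zpow_def Rep_torus_sq power_int_mult_distrib power2_eq_square prod.distrib)

lemma finite_cube [simp]: "finite (cube :: (int ^ 'd::finite) set)"
proof -
  have "cube \<subseteq> (\<lambda>S. \<chi> n. of_bool (n \<in> S)) ` (UNIV :: 'd set set)"
  proof
    fix k :: "int ^ 'd" assume "k \<in> cube"
    then have "k = (\<chi> n. of_bool (n \<in> {n. k $ n = 1}))"
      by (force simp: cube_def vec_eq_iff)
    then show "k \<in> (\<lambda>S. \<chi> n. of_bool (n \<in> S)) ` (UNIV :: 'd set set)"
      by blast
  qed
  then show ?thesis
    by (rule finite_subset) simp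
qed

lemma zero_in_cube [simp]: "0 \<in> cube"
  by (simp add: cube_def)

text \<open>A pointwise replacement for \<open>laurent_conj\<close>, which is a definite description
  over expansions. It respects the ring operations on all functions, and
  \<open>laurent_conj_eq\<close> identifies the two on \<open>laurent_l1\<close>.\<close>

definition conj_fun :: "('a \<Rightarrow> complex) \<Rightarrow> 'a \<Rightarrow> complex" where
  "conj_fun F = (\<lambda>z. cnj (F z))"

lemma conj_fun_simps [simp]:
  "conj_fun (F + G) = conj_fun F + conj_fun G"
  "conj_fun (F - G) = conj_fun F - conj_fun G"
  "conj_fun (F * G) = conj_fun F * conj_fun G"
  "conj_fun (- F) = - conj_fun F"
  "conj_fun 0 = 0"
  "conj_fun 1 = 1"
  "conj_fun (conj_fun F) = F"
  by (auto simp: conj_fun_def fun_eq_iff)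

lemma conj_fun_sum: "conj_fun (\<Sum>i\<in>I. f i) = (\<Sum>i\<in>I. conj_fun (f i))"
  by (simp add: conj_fun_def fun_eq_iff sum_fun_apply)

lemma conj_fun_zpow: "conj_fun (zpow k) = zpow (- k)"
  by (simp add: conj_fun_def cnj_zpow)

lemma conj_fun_eq_0_iff [simp]: "conj_fun F = 0 \<longleftrightarrow> F = 0"
  by (auto simp: conj_fun_def fun_eq_iff)

section \<open>Laurent polynomials and absolutely convergent Laurent series\<close>

text \<open>Terms with equal exponents are collected fibre by fibre. Allowing repetitions lets
  products and sums be indexed by \<open>M \<times> N\<close> and \<open>M <+> N\<close> as they
  stand.\<close>

lemma laurent_polyI:
  assumes "finite I"
  shows "(\<lambda>z. \<Sum>i\<in>I. a i * zpow (p i) z) \<in> laurent_poly"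
proof -
  have "(\<Sum>i\<in>I. a i * zpow (p i) z) = (\<Sum>k\<in>p ` I. (\<Sum>i\<in>{i\<in>I. p i = k}. a i) * zpow k z)" for z
    unfolding sum.image_gen[OF assms, of "\<lambda>i. a i * zpow (p i) z" p] sum_distrib_right
    by (intro sum.cong) auto
  then have "(\<lambda>z. \<Sum>i\<in>I. a i * zpow (p i) z) =
    (\<lambda>z. \<Sum>k\<in>p ` I. (\<Sum>i\<in>{i\<in>I. p i = k}. a i) * zpow k z)"
    by blast
  with assms show ?thesis
    unfolding laurent_poly_def by (intro CollectI exI conjI) auto
qed

lemma laurent_polyE:
  assumes "P \<in> laurent_poly"
  obtains M a where "finite M" "P = (\<lambda>z. \<Sum>k\<in>M. a k * zpow k z)"
  using assms unfolding laurent_poly_def by blast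

lemma laurent_poly_zpow: "zpow k \<in> laurent_poly"
  using laurent_polyI[of "{k}" "\<lambda>_. 1" id] by simp

lemma laurent_poly_mult:
  assumes "P \<in> laurent_poly" "Q \<in> laurent_poly"
  shows "P * Q \<in> laurent_poly"
proof -
  obtain M a where M: "finite M" "P = (\<lambda>z. \<Sum>k\<in>M. a k * zpow k z)"
    using assms(1) by (rule laurent_polyE)
  obtain N b where N: "finite N" "Q = (\<lambda>z. \<Sum>k\<in>N. b k * zpow k z)"
    using assms(2) by (rule laurent_polyE)
  have "P * Q = (\<lambda>z. \<Sum>x\<in>M \<times> N. (a (fst x) * b (snd x)) * zpow (fst x + snd x) z)"
    by (simp add: M N fun_eq_iff sum_product sum.cartesian_product zpow_add case_prod_unfold mult_ac)
  then show ?thesis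
    using laurent_polyI[of "M \<times> N"] M(1) N(1) by simp
qed

lemma laurent_poly_minus:
  assumes "P \<in> laurent_poly"
  shows "- P \<in> laurent_poly"
proof -
  have "- (1 :: 'a torus \<Rightarrow> complex) \<in> laurent_poly"
    using laurent_polyI[of "{0}" "\<lambda>_. - 1" id] by (simp add: fun_Compl_def)
  from laurent_poly_mult[OF this assms] show ?thesis
    by simp
qed

lemma laurent_poly_add:
  assumes "P \<in> laurent_poly" "Q \<in> laurent_poly"
  shows "P + Q \<in> laurent_poly"
proof -
  obtain M a where M: "finite M" "P = (\<lambda>z. \<Sum>k\<in>M. a k * zpow k z)"
    using assms(1) by (rule laurent_polyE)
  obtain N b where N: "finite N" "Q = (\<lambda>z. \<Sum>k\<in>N. b k * zpow k z)"
    using assms(2) by (rule laurent_polyE)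
  have "P + Q = (\<lambda>z. \<Sum>x\<in>M <+> N. case_sum a b x * zpow (case_sum id id x) z)"
    by (simp add: M N fun_eq_iff sum.Plus)
  then show ?thesis
    using laurent_polyI[of "M <+> N"] M(1) N(1) by simp
qed

lemma laurent_poly_diff: "P \<in> laurent_poly \<Longrightarrow> Q \<in> laurent_poly \<Longrightarrow> P - Q \<in> laurent_poly"
  using laurent_poly_add[OF _ laurent_poly_minus, of P Q] by simp

lemma laurent_poly_conj:
  assumes "P \<in> laurent_poly"
  shows "conj_fun P \<in> laurent_poly"
  using assms
proof (rule laurent_polyE)
  fix M a assume M: "finite M" "P = (\<lambda>z. \<Sum>k\<in>M. a k * zpow k z)"
  then have "conj_fun P = (\<lambda>z. \<Sum>k\<in>M. cnj (a k) * zpow (- k) z)"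
    by (simp add: conj_fun_def cnj_zpow)
  then show ?thesis
    using laurent_polyI M(1) by simp
qed

lemma laurent_poly_down_subset: "laurent_poly_down \<subseteq> laurent_poly"
proof
  fix P :: "'d::finite torus \<Rightarrow> complex" assume "P \<in> laurent_poly_down"
  then obtain Q where Q: "Q \<in> laurent_poly" "P = Q \<circ> torus_sq"
    unfolding laurent_poly_down_def by blast
  obtain M a where M: "finite M" "Q = (\<lambda>z. \<Sum>k\<in>M. a k * zpow k z)"
    using Q(1) by (rule laurent_polyE)
  show "P \<in> laurent_poly"
    using laurent_polyI[OF M(1), of a "\<lambda>k. k + k"] by (simp add: Q(2) M(2) comp_def zpow_torus_sq)
qed

text \<open>
  Allowing repeated exponents over an arbitrary index set reduces the closure properties of
  \<open>\<L>(\<ell>\<^sub>1)\<close> (products, conjugates, \<open>z \<mapsto> z\<^sup>2\<close>) to summability of the coefficients.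
\<close>

lemma laurent_l1I:
  assumes "(\<lambda>i. norm (a i)) summable_on I"
  shows "(\<lambda>z. \<Sum>\<^sub>\<infinity>i\<in>I. a i * zpow (p i) z) \<in> laurent_l1"
proof -
  let ?J = "\<lambda>k. {i\<in>I. p i = k}"
  let ?h = "snd :: _ \<times> 'a \<Rightarrow> 'a"
  \<comment> \<open>The fibres of \<open>p\<close> partition \<open>I\<close>, so the family can be
    regrouped over pairs of an exponent and an index.\<close>
  have bij: "bij_betw ?h (Sigma UNIV ?J) I"
    by (rule bij_betwI[where g = "\<lambda>i. (p i, i)"]) auto
  have sum: "(\<lambda>x. norm (a (snd x))) summable_on Sigma UNIV ?J"
    using summable_on_reindex_bij_betw[OF bij, of "\<lambda>i. norm (a i)"] assms by simp
  have J: "(\<lambda>i. norm (a i)) summable_on ?J k"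
    and S: "(\<lambda>k. norm (\<Sum>\<^sub>\<infinity>i\<in>?J k. norm (a i))) summable_on UNIV" for k
    using sum[unfolded Infinite_Sum.abs_summable_on_Sigma_iff] by simp_all
  \<comment> \<open>The coefficient of \<open>zpow k\<close> once all terms with that exponent are
    collected. The fibre sums in \<open>S\<close> dominate it, which puts \<open>b\<close> in
    \<open>ell1\<close>.\<close>
  define b where "b k = infsum a (?J k)" for k
  have "norm (b k) \<le> norm (\<Sum>\<^sub>\<infinity>i\<in>?J k. norm (a i))" for k
    unfolding b_def real_norm_def by (rule order_trans[OF norm_infsum_bound[OF J] abs_ge_self])
  then have "b \<in> ell1"
    unfolding ell1_def mem_Collect_eq using Infinite_Sum.abs_summable_on_comparison_test[OF S, of b] by simp
  moreover have "(\<Sum>\<^sub>\<infinity>i\<in>I. a i * zpow (p i) z) = (\<Sum>\<^sub>\<infinity>k. b k * zpow k z)" for z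
  proof -
    let ?f = "\<lambda>x. a (snd x) * zpow (p (snd x)) z"
    have fibre: "(\<Sum>\<^sub>\<infinity>i\<in>?J k. ?f (k, i)) = b k * zpow k z" for k
    proof -
      have "(\<Sum>\<^sub>\<infinity>i\<in>?J k. ?f (k, i)) = (\<Sum>\<^sub>\<infinity>i\<in>?J k. a i * zpow k z)"
        by (rule infsum_cong) auto
      then show ?thesis
        by (simp add: b_def infsum_cmult_left')
    qed
    have "(\<Sum>\<^sub>\<infinity>i\<in>I. a i * zpow (p i) z) = infsum ?f (Sigma UNIV ?J)"
      using infsum_reindex_bij_betw[OF bij, of "\<lambda>i. a i * zpow (p i) z"] by simp
    also have "\<dots> = (\<Sum>\<^sub>\<infinity>k. \<Sum>\<^sub>\<infinity>i\<in>?J k. ?f (k, i))"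
      by (rule infsum_Sigma_banach[symmetric, OF abs_summable_summable]) (use sum in \<open>simp add: norm_mult\<close>)
    finally show ?thesis
      unfolding fibre .
  qed
  ultimately show ?thesis
    unfolding laurent_l1_def by (intro CollectI bexI[of _ b] ext) simp_all
qed

lemma laurent_l1E:
  assumes "F \<in> laurent_l1"
  obtains a where "(\<lambda>k. norm (a k)) summable_on UNIV" "F = (\<lambda>z. \<Sum>\<^sub>\<infinity>k. a k * zpow k z)"
  using assms unfolding laurent_l1_def ell1_def by blast

lemma laurent_poly_subset_l1: "laurent_poly \<subseteq> laurent_l1"
proof
  fix P :: "'d::finite torus \<Rightarrow> complex" assume "P \<in> laurent_poly"
  then obtain M a where M: "finite M" "P = (\<lambda>z. \<Sum>k\<in>M. a k * zpow k z)"
    by (rule laurent_polyE)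
  then show "P \<in> laurent_l1"
    using laurent_l1I[of a M "\<lambda>k. k"] by simp
qed

lemma summable_on_zpow:
  assumes "(\<lambda>i. norm (a i)) summable_on I"
  shows "(\<lambda>i. norm (a i * zpow (p i) z)) summable_on I"
  using assms by (simp add: norm_mult)

text \<open>The products of coefficients form an absolutely summable family over pairs. Fubini gives
  the product of the functions, and \<open>laurent_l1I\<close> collects the pairs with equal
  \<open>k + l\<close>, which is the convolution.\<close>

lemma laurent_l1_mult:
  assumes "F \<in> laurent_l1" "G \<in> laurent_l1"
  shows "F * G \<in> laurent_l1"
proof -
  obtain a where a: "(\<lambda>k. norm (a k)) summable_on UNIV" "F = (\<lambda>z. \<Sum>\<^sub>\<infinity>k. a k * zpow k z)"
    using assms(1) by (rule laurent_l1E)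
  obtain b where b: "(\<lambda>k. norm (b k)) summable_on UNIV" "G = (\<lambda>z. \<Sum>\<^sub>\<infinity>k. b k * zpow k z)"
    using assms(2) by (rule laurent_l1E)
  let ?c = "\<lambda>x. a (fst x) * b (snd x)"
  have c: "(\<lambda>x. norm (?c x)) summable_on UNIV \<times> UNIV"
    unfolding Infinite_Sum.abs_summable_on_Sigma_iff
    using a(1) b(1)
    by (auto simp: norm_mult infsum_cmult_right' abs_mult intro!: summable_on_cmult_right summable_on_cmult_left)
  have "(F * G) z = (\<Sum>\<^sub>\<infinity>x\<in>UNIV \<times> UNIV. ?c x * zpow (fst x + snd x) z)" for z
  proof -
    have "(F * G) z = (\<Sum>\<^sub>\<infinity>k. \<Sum>\<^sub>\<infinity>l. (a k * zpow k z) * (b l * zpow l z))"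
      by (simp add: a b infsum_cmult_left' infsum_cmult_right')
    also have "\<dots> = (\<Sum>\<^sub>\<infinity>k. \<Sum>\<^sub>\<infinity>l. ?c (k, l) * zpow (fst (k, l) + snd (k, l)) z)"
      by (simp add: zpow_add mult_ac)
    also have "\<dots> = (\<Sum>\<^sub>\<infinity>x\<in>UNIV \<times> UNIV. ?c x * zpow (fst x + snd x) z)"
      by (rule infsum_Sigma_banach) (rule abs_summable_summable, rule summable_on_zpow[OF c])
    finally show ?thesis .
  qed
  then have "F * G = (\<lambda>z. \<Sum>\<^sub>\<infinity>x\<in>UNIV \<times> UNIV. ?c x * zpow (fst x + snd x) z)"
    by blast
  then show ?thesis
    using laurent_l1I[OF c, of "\<lambda>x. fst x + snd x"] by simp
qed

lemma laurent_l1_add: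
  assumes "F \<in> laurent_l1" "G \<in> laurent_l1"
  shows "F + G \<in> laurent_l1"
proof -
  obtain a where a: "(\<lambda>k. norm (a k)) summable_on UNIV" "F = (\<lambda>z. \<Sum>\<^sub>\<infinity>k. a k * zpow k z)"
    using assms(1) by (rule laurent_l1E)
  obtain b where b: "(\<lambda>k. norm (b k)) summable_on UNIV" "G = (\<lambda>z. \<Sum>\<^sub>\<infinity>k. b k * zpow k z)"
    using assms(2) by (rule laurent_l1E)
  have "(\<lambda>k. norm (a k + b k)) summable_on UNIV"
    using summable_on_add[OF a(1) b(1)]
    by (rule Infinite_Sum.abs_summable_on_comparison_test') (rule norm_triangle_ineq)
  moreover have "F + G = (\<lambda>z. \<Sum>\<^sub>\<infinity>k. (a k + b k) * zpow k z)"
    by (simp add: a(2) b(2) fun_eq_iff distrib_right infsum_add abs_summable_summable[OF summable_on_zpow] a(1) b(1))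
  ultimately show ?thesis
    using laurent_l1I[of "\<lambda>k. a k + b k" UNIV "\<lambda>k. k"] by simp
qed

lemma laurent_l1_conj:
  assumes "F \<in> laurent_l1"
  shows "conj_fun F \<in> laurent_l1"
  using assms
proof (rule laurent_l1E)
  fix a assume a: "(\<lambda>k. norm (a k)) summable_on UNIV" "F = (\<lambda>z. \<Sum>\<^sub>\<infinity>k. a k * zpow k z)"
  then have "conj_fun F = (\<lambda>z. \<Sum>\<^sub>\<infinity>k. cnj (a k) * zpow (- k) z)"
    by (simp add: conj_fun_def cnj_zpow flip: infsum_cnj)
  then show ?thesis
    using laurent_l1I[of "\<lambda>k. cnj (a k)" UNIV uminus] a(1) by simp
qed

text \<open>Every expansion of \<open>F\<close> leads to the same function, its pointwise conjugate,
  so the description has exactly one solution.\<close>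

lemma laurent_conj_eq:
  fixes F :: "('d::finite) torus \<Rightarrow> complex"
  assumes "F \<in> laurent_l1"
  shows "laurent_conj F = conj_fun F"
proof -
  have expand: "(\<lambda>z. \<Sum>\<^sub>\<infinity>k. cnj (a k) * zpow (- k) z) = conj_fun (\<lambda>z. \<Sum>\<^sub>\<infinity>k. a k * zpow k z)"
    for a :: "int ^ 'd \<Rightarrow> complex"
    by (simp add: conj_fun_def cnj_zpow flip: infsum_cnj)
  show ?thesis
    unfolding laurent_conj_def expand
    by (rule the_equality) (use assms in \<open>auto simp: laurent_l1_def\<close>)
qed

section \<open>Ring operations on absolutely convergent series and on the subring of series in
  \<open>z^2\<close>\<close>

lemma laurent_l1_downI: "F \<in> laurent_l1 \<Longrightarrow> F \<circ> torus_sq \<in> laurent_l1_down"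
  unfolding laurent_l1_down_def by blast

lemma laurent_l1_downE:
  assumes "f \<in> laurent_l1_down"
  obtains F where "F \<in> laurent_l1" "f = F \<circ> torus_sq"
  using assms unfolding laurent_l1_down_def by blast

lemma laurent_l1_minus:
  assumes "F \<in> laurent_l1"
  shows "- F \<in> laurent_l1"
proof -
  have "- 1 \<in> laurent_l1"
    using laurent_poly_minus[OF laurent_poly_zpow[of 0]] laurent_poly_subset_l1 by auto
  from laurent_l1_mult[OF this assms] show ?thesis
    by simp
qed

lemma laurent_l1_zpow: "zpow k \<in> laurent_l1"
  using laurent_poly_zpow laurent_poly_subset_l1 by blast

lemma laurent_l1_1: "1 \<in> laurent_l1"
  using laurent_l1_zpow[of 0] by simp

lemma laurent_l1_0: "0 \<in> laurent_l1"
  using laurent_l1_add[OF laurent_l1_1 laurent_l1_minus[OF laurent_l1_1]] by simp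

lemma laurent_l1_sum: "(\<And>i. i \<in> I \<Longrightarrow> f i \<in> laurent_l1) \<Longrightarrow> (\<Sum>i\<in>I. f i) \<in> laurent_l1"
  by (induction I rule: infinite_finite_induct) (auto intro: laurent_l1_0 laurent_l1_add)

lemma pointwise_comp:
  fixes F G :: "'a \<Rightarrow> complex" and h :: "'b \<Rightarrow> 'a"
  shows "(F \<circ> h) + (G \<circ> h) = (F + G) \<circ> h"
    and "(F \<circ> h) * (G \<circ> h) = (F * G) \<circ> h"
    and "- (F \<circ> h) = (- F) \<circ> h"
    and "conj_fun (F \<circ> h) = conj_fun F \<circ> h"
  by (auto simp: fun_eq_iff conj_fun_def)

lemma laurent_l1_down_add: "f \<in> laurent_l1_down \<Longrightarrow> g \<in> laurent_l1_down \<Longrightarrow> f + g \<in> laurent_l1_down"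
  by (elim laurent_l1_downE) (simp add: pointwise_comp laurent_l1_downI laurent_l1_add)

lemma laurent_l1_down_mult: "f \<in> laurent_l1_down \<Longrightarrow> g \<in> laurent_l1_down \<Longrightarrow> f * g \<in> laurent_l1_down"
  by (elim laurent_l1_downE) (simp add: pointwise_comp laurent_l1_downI laurent_l1_mult)

lemma laurent_l1_down_minus: "f \<in> laurent_l1_down \<Longrightarrow> - f \<in> laurent_l1_down"
  by (elim laurent_l1_downE) (simp add: pointwise_comp laurent_l1_downI laurent_l1_minus)

lemma laurent_l1_down_conj: "f \<in> laurent_l1_down \<Longrightarrow> conj_fun f \<in> laurent_l1_down"
  by (elim laurent_l1_downE) (simp add: pointwise_comp laurent_l1_downI laurent_l1_conj)

lemma laurent_l1_down_0: "0 \<in> laurent_l1_down"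
  using laurent_l1_downI[OF laurent_l1_0] by (simp add: comp_def zero_fun_def)

lemma laurent_l1_down_subset: "laurent_l1_down \<subseteq> laurent_l1"
proof
  fix f :: "'d::finite torus \<Rightarrow> complex" assume "f \<in> laurent_l1_down"
  then obtain a where a: "(\<lambda>k. norm (a k)) summable_on UNIV" "f = (\<lambda>z. \<Sum>\<^sub>\<infinity>k. a k * zpow k z) \<circ> torus_sq"
    by (elim laurent_l1_downE laurent_l1E) simp
  then show "f \<in> laurent_l1"
    using laurent_l1I[OF a(1), of "\<lambda>k. k + k"] by (simp add: comp_def zpow_torus_sq)
qed

lemma laurent_poly_down_subset_l1: "laurent_poly_down \<subseteq> laurent_l1_down"
  unfolding laurent_poly_down_def laurent_l1_down_def using laurent_poly_subset_l1 by blast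

section \<open>Averaging over sign changes\<close>

text \<open>The action of the group of sign vectors on the torus, a sign vector being encoded by the
  set of coordinates that it negates.\<close>

definition flip :: "'d set \<Rightarrow> ('d::finite) torus \<Rightarrow> 'd torus" where
  "flip S z = Abs_torus (\<chi> n. if n \<in> S then - Rep_torus z $ n else Rep_torus z $ n)"

lemma Rep_flip: "Rep_torus (flip S z) $ n = (if n \<in> S then - Rep_torus z $ n else Rep_torus z $ n)"
  by (simp add: flip_def Abs_torus_inverse)

lemma torus_sq_flip: "torus_sq (flip S z) = torus_sq z"
  by (simp add: Rep_torus_inject[symmetric] vec_eq_iff Rep_torus_sq Rep_flip)

lemma laurent_l1_down_flip: "f \<in> laurent_l1_down \<Longrightarrow> f (flip S z) = f z"
  by (elim laurent_l1_downE) (simp add: torus_sq_flip)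

text \<open>Monomials are common eigenvectors of all sign changes, with a character of the sign
  group as eigenvalue.\<close>

lemma zpow_flip: "zpow k (flip S z) = (\<Prod>n\<in>S. (- 1) powi (k $ n)) * zpow k z"
proof -
  have "zpow k (flip S z) = (\<Prod>n\<in>UNIV. (if n \<in> S then (- 1) powi (k $ n) else 1) * Rep_torus z $ n powi (k $ n))"
    unfolding zpow_def Rep_flip
    by (rule prod.cong) (auto simp flip: power_int_mult_distrib)
  then show ?thesis
    by (simp add: prod.distrib zpow_def prod.If_cases)
qed

definition avg :: "(('d::finite) torus \<Rightarrow> complex) \<Rightarrow> 'd torus \<Rightarrow> complex" where
  "avg F z = (\<Sum>S\<in>UNIV. F (flip S z)) / 2 ^ CARD('d)"

lemma avg_sum: "avg (\<Sum>i\<in>I. f i) = (\<Sum>i\<in>I. avg (f i))"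
  by (auto simp: fun_eq_iff avg_def sum_fun_apply sum_divide_distrib intro: sum.swap)

lemma avg_add: "avg (F + G) = avg F + avg G"
  by (simp add: fun_eq_iff avg_def sum.distrib add_divide_distrib)

text \<open>Series in \<open>z^2\<close> are invariant under sign changes, so they act as scalars
  for the average.\<close>

lemma avg_mult_down: "f \<in> laurent_l1_down \<Longrightarrow> avg (f * F) = f * avg F"
  by (simp add: fun_eq_iff avg_def laurent_l1_down_flip flip: sum_distrib_left)

text \<open>The sum of the eigenvalues over all \<open>S\<close> is the expansion of the product of
  the factors \<open>(- 1) powi (k $ n) + 1\<close>. Each factor is 2 or 0 according to the parity
  of \<open>k $ n\<close>.\<close>

lemma avg_zpow: "avg (zpow k) = (if \<forall>n. even (k $ n) then zpow k else 0)"
proof -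
  have "avg (zpow k) z = (\<Prod>n\<in>UNIV. (- 1) powi (k $ n) + 1) / 2 ^ CARD('a) * zpow k z" for z
    by (simp add: avg_def zpow_flip prod_add Pow_UNIV flip: sum_distrib_right)
  moreover have "(\<Prod>n\<in>UNIV. (- 1) powi (k $ n) + 1 :: complex) = 
    (if \<forall>n. even (k $ n) then 2 ^ CARD('a) else 0)"
    by (auto simp: power_int_minus_left)
  ultimately show ?thesis
    by (auto simp: fun_eq_iff)
qed

lemma avg_zpow_diff:
  assumes "j \<in> cube" "k \<in> cube"
  shows "avg (zpow (j - k)) = (if j = k then 1 else 0)"
proof -
  have "even (j $ n - k $ n) \<longleftrightarrow> j $ n = k $ n" for n
    using assms[unfolded cube_def mem_Collect_eq, rule_format, of n] by auto
  then show ?thesis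
    using zpow_0 by (auto simp: avg_zpow simp flip: vec_eq_iff)
qed

text \<open>Multiplying by \<open>zpow (- k)\<close> moves the coefficient at \<open>k\<close> to
  the even exponents, where the average reads it off. This also shows that the coefficients in an
  expansion are unique.\<close>

lemma avg_expansion:
  assumes "\<And>j. j \<in> cube \<Longrightarrow> a j \<in> laurent_l1_down" "k \<in> cube"
  shows "avg ((\<Sum>j\<in>cube. a j * zpow j) * zpow (- k)) = a k"
proof -
  have "avg ((\<Sum>j\<in>cube. a j * zpow j) * zpow (- k)) = (\<Sum>j\<in>cube. avg (a j * zpow (j - k)))"
    by (simp add: sum_distrib_right mult.assoc zpow_mult flip: avg_sum)
  also have "\<dots> = (\<Sum>j\<in>cube. if j = k then a j else 0)"
    by (rule sum.cong) (auto simp: avg_mult_down assms avg_zpow_diff)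
  finally show ?thesis
    using assms(2) by simp
qed

section \<open>Splitting series by parity of exponents, and \<open>rho\<close> as an average\<close>

lemma has_sum_finite_sum:
  fixes f :: "'a \<Rightarrow> 'b \<Rightarrow> 'c::topological_comm_monoid_add"
  assumes "\<And>j. j \<in> J \<Longrightarrow> (f j has_sum s j) A"
  shows "((\<lambda>k. \<Sum>j\<in>J. f j k) has_sum (\<Sum>j\<in>J. s j)) A"
  using assms by (induction J rule: infinite_finite_induct) (auto intro: has_sum_add)

text \<open>Exponents are sorted by their residue modulo 2. The part with residue \<open>j\<close>
  is \<open>zpow j\<close> times a series with even exponents.\<close>

lemma laurent_l1_expansion:
  fixes F :: "('d::finite) torus \<Rightarrow> complex"
  assumes "F \<in> laurent_l1"
  obtains f where "\<And>j. j \<in> cube \<Longrightarrow> f j \<in> laurent_l1_down" "F = (\<Sum>j\<in>cube. f j * zpow j)"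
proof -
  obtain a where a: "(\<lambda>k. norm (a k)) summable_on UNIV" "F = (\<lambda>z. \<Sum>\<^sub>\<infinity>k. a k * zpow k z)"
    using assms by (elim laurent_l1E)
  define par :: "int ^ 'd \<Rightarrow> int ^ 'd" where "par k = (\<chi> n. k $ n mod 2)" for k
  define half :: "int ^ 'd \<Rightarrow> int ^ 'd" where "half k = (\<chi> n. k $ n div 2)" for k
  have k: "k = half k + half k + par k" for k
    unfolding vec_eq_iff par_def half_def by simp
  have par: "par k \<in> cube" for k
    by (simp add: par_def cube_def mod2_eq_if)
  \<comment> \<open>Extension by zero keeps all sums over the whole lattice instead of one parity
    class each.\<close>
  define b where "b j k = (if par k = j then a k else 0)" for j k
  have b: "(\<lambda>k. norm (b j k)) summable_on UNIV" for j
    by (rule Infinite_Sum.abs_summable_on_comparison_test'[OF a(1)]) (simp add: b_def)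
  define f where "f j = (\<lambda>z. \<Sum>\<^sub>\<infinity>k. b j k * zpow (half k) z) \<circ> torus_sq" for j
  have "F z = (\<Sum>j\<in>cube. f j * zpow j) z" for z
  proof -
    have "((\<lambda>k. b j k * zpow k z) has_sum f j z * zpow j z) UNIV" for j
    proof -
      have "((\<lambda>k. b j k * zpow (half k) (torus_sq z) * zpow j z) has_sum f j z * zpow j z) UNIV"
        unfolding f_def comp_def
        by (rule has_sum_cmult_left[OF has_sum_infsum[OF abs_summable_summable[OF summable_on_zpow[OF b]]]])
      \<comment> \<open>Off the parity class both sides vanish; on it \<open>par k = j\<close> and
        the decomposition of \<open>k\<close> applies.\<close>
      moreover have "b j k * zpow (half k) (torus_sq z) * zpow j z = b j k * zpow k z" for k
        using arg_cong[OF k[of k], of "\<lambda>k. zpow k z"] by (simp add: b_def zpow_torus_sq zpow_add)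
      ultimately show ?thesis by simp
    qed
    then have "((\<lambda>k. \<Sum>j\<in>cube. b j k * zpow k z) has_sum (\<Sum>j\<in>cube. f j z * zpow j z)) UNIV"
      by (intro has_sum_finite_sum)
    \<comment> \<open>For each \<open>k\<close> only the term \<open>j = par k\<close>
      survives.\<close>
    moreover have "(\<Sum>j\<in>cube. b j k * zpow k z) = a k * zpow k z" for k
      using par[of k] by (simp add: b_def flip: sum_distrib_right)
    ultimately show ?thesis
      by (simp add: a(2) infsumI sum_fun_apply)
  qed
  then have "F = (\<Sum>j\<in>cube. f j * zpow j)"
    by blast
  moreover have "f j \<in> laurent_l1_down" for j
    unfolding f_def by (intro laurent_l1_downI laurent_l1I b)
  ultimately show ?thesis
    by (intro that[of f])
qed

text \<open>The parity splitting supplies an expansion, and \<open>avg_expansion\<close> at exponent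
  0 shows that every expansion has \<open>avg A\<close> as its zeroth coefficient.\<close>

lemma rho_eq_avg:
  assumes "A \<in> laurent_l1"
  shows "rho A = avg A"
proof -
  have a0: "avg A = a 0" if "\<forall>j\<in>cube. a j \<in> laurent_l1_down" "A = (\<Sum>j\<in>cube. a j * zpow j)" for a
    using that avg_expansion[of a 0] by simp
  obtain a where "\<And>j. j \<in> cube \<Longrightarrow> a j \<in> laurent_l1_down" "A = (\<Sum>j\<in>cube. a j * zpow j)"
    using laurent_l1_expansion[OF assms] by blast
  with a0 show ?thesis
    unfolding rho_def by (intro the_equality) (blast, metis)
qed

lemma avg_in_down:
  assumes "F \<in> laurent_l1"
  shows "avg F \<in> laurent_l1_down"
proof -
  obtain f where f: "\<And>j. j \<in> cube \<Longrightarrow> f j \<in> laurent_l1_down" "F = (\<Sum>j\<in>cube. f j * zpow j)"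
    using laurent_l1_expansion[OF assms] by blast
  show ?thesis
    using avg_expansion[OF f(1) zero_in_cube] f by simp
qed

lemma rho_U_eq_avg:
  assumes "U \<in> laurent_l1" "F \<in> laurent_l1"
  shows "rho_U U F = avg (U * conj_fun F)"
  unfolding rho_U_def laurent_conj_eq[OF assms(2)]
  by (intro rho_eq_avg laurent_l1_mult laurent_l1_conj assms)

lemma expansion_in_l1:
  assumes "\<And>j. j \<in> cube \<Longrightarrow> f j \<in> laurent_l1_down"
  shows "(\<Sum>j\<in>cube. f j * zpow j) \<in> laurent_l1"
  using assms laurent_l1_down_subset by (intro laurent_l1_sum laurent_l1_mult laurent_l1_zpow) blast

lemma rho_U_expansion:
  assumes u: "\<And>j. j \<in> cube \<Longrightarrow> u j \<in> laurent_l1_down"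
    and f: "\<And>j. j \<in> cube \<Longrightarrow> f j \<in> laurent_l1_down"
  shows "rho_U (\<Sum>j\<in>cube. u j * zpow j) (\<Sum>j\<in>cube. f j * zpow j) = (\<Sum>j\<in>cube. u j * conj_fun (f j))"
    (is "rho_U ?U ?F = _")
proof -
  have "rho_U ?U ?F = avg (?U * conj_fun ?F)"
    by (intro rho_U_eq_avg expansion_in_l1 u f)
  \<comment> \<open>Conjugation turns \<open>zpow j\<close> into \<open>zpow (- j)\<close>, so each
    summand is in the form from which \<open>avg_expansion\<close> extracts
    \<open>u j\<close>.\<close>
  also have "?U * conj_fun ?F = (\<Sum>j\<in>cube. conj_fun (f j) * (?U * zpow (- j)))"
    by (simp add: conj_fun_sum conj_fun_zpow sum_distrib_left mult_ac)
  also have "avg \<dots> = (\<Sum>j\<in>cube. conj_fun (f j) * u j)"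
    unfolding avg_sum
    by (rule sum.cong) (simp_all add: avg_mult_down laurent_l1_down_conj f avg_expansion u)
  finally show ?thesis
    by (simp only: mult.commute)
qed

lemma basis_over_zpow: "basis_over laurent_l1_down laurent_l1 (cube :: (int ^ 'd::finite) set) zpow"
  unfolding basis_over_def
proof (intro conjI allI impI ballI)
  fix c :: "int ^ 'd \<Rightarrow> 'd torus \<Rightarrow> complex" and k :: "int ^ 'd"
  assume c: "\<forall>j\<in>cube. c j \<in> laurent_l1_down" "(\<Sum>j\<in>cube. c j * zpow j) = 0" and k: "k \<in> cube"
  have "c k = avg (0 * zpow (- k))"
    using avg_expansion[of c k] c k by simp
  then show "c k = 0"
    by (simp add: avg_def fun_eq_iff)
next
  show "(laurent_l1 :: ('d torus \<Rightarrow> complex) set) = {\<Sum>j\<in>cube. c j * zpow j |c. \<forall>j\<in>cube. c j \<in> laurent_l1_down}" (is "_ = ?S")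
  proof (intro equalityI subsetI)
    fix F :: "'d torus \<Rightarrow> complex" assume "F \<in> laurent_l1"
    then show "F \<in> ?S"
      by (rule laurent_l1_expansion) blast
  qed (auto intro: expansion_in_l1)
qed simp

section \<open>Bases over a subring\<close>

lemma basis_over_cong:
  assumes "\<And>j. j \<in> I \<Longrightarrow> b j = b' j"
  shows "basis_over R M I b = basis_over R M I b'"
proof -
  have "(\<Sum>j\<in>I. c j * b j) = (\<Sum>j\<in>I. c j * b' j)" for c
    using assms by (intro sum.cong) simp_all
  then show ?thesis
    unfolding basis_over_def by simp
qed

text \<open>Serves to pass from the index \<open>j\<close> to \<open>s = |j - i|\<close>, the index
  that \<open>H_gen\<close> takes.\<close>

lemma basis_over_reindex:
  assumes h: "bij_betw h I J" and basis: "basis_over R M I (\<lambda>i. b (h i))"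
  shows "basis_over R M J b"
proof -
  have sum: "(\<Sum>i\<in>I. c (h i) * b (h i)) = (\<Sum>j\<in>J. c j * b j)" for c
    using sum.reindex_bij_betw[OF h, of "\<lambda>j. c j * b j"] .
  have hI: "h i \<in> J" if "i \<in> I" for i
    using h that by (auto simp: bij_betw_def)
  have J: "J = h ` I"
    using h by (simp add: bij_betw_def)
  have indep: "\<forall>i\<in>I. c i = 0" if "\<forall>i\<in>I. c i \<in> R" "(\<Sum>i\<in>I. c i * b (h i)) = 0" for c
    using basis that unfolding basis_over_def by blast
  have "finite J"
    using h basis by (auto simp: basis_over_def J)
  moreover have "\<forall>j\<in>J. c j = 0" if "\<forall>j\<in>J. c j \<in> R" "(\<Sum>j\<in>J. c j * b j) = 0" for c
  proof -
    have "(\<Sum>i\<in>I. c (h i) * b (h i)) = 0"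
      using sum[of c] that(2) by simp
    moreover have "\<forall>i\<in>I. c (h i) \<in> R"
      using that(1) hI by blast
    ultimately have "\<forall>i\<in>I. c (h i) = 0"
      by (intro indep)
    then show ?thesis
      by (simp add: J)
  qed
  moreover have "M = {\<Sum>j\<in>J. c j * b j |c. \<forall>j\<in>J. c j \<in> R}"
  proof -
    have "M = {\<Sum>i\<in>I. c i * b (h i) |c. \<forall>i\<in>I. c i \<in> R}"
      using basis by (simp add: basis_over_def)
    also have "\<dots> = {\<Sum>j\<in>J. c j * b j |c. \<forall>j\<in>J. c j \<in> R}"
    proof (intro equalityI subsetI; clarify)
      fix c assume c: "\<forall>i\<in>I. c i \<in> R"
      have inv: "the_inv_into I h (h i) = i" if "i \<in> I" for i
        using h that by (auto simp: bij_betw_def the_inv_into_f_f)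
      have "(\<Sum>i\<in>I. c i * b (h i)) = (\<Sum>j\<in>J. c (the_inv_into I h j) * b j)"
        using sum[of "\<lambda>j. c (the_inv_into I h j)"] by (simp add: inv)
      moreover have "\<forall>j\<in>J. c (the_inv_into I h j) \<in> R"
        using c by (simp add: J inv)
      ultimately show "\<exists>d. (\<Sum>i\<in>I. c i * b (h i)) = (\<Sum>j\<in>J. d j * b j) \<and> (\<forall>j\<in>J. d j \<in> R)"
        by (intro exI[of _ "\<lambda>j. c (the_inv_into I h j)"] conjI)
    next
      fix c assume "\<forall>j\<in>J. c j \<in> R"
      then show "\<exists>d. (\<Sum>j\<in>J. c j * b j) = (\<Sum>i\<in>I. d i * b (h i)) \<and> (\<forall>i\<in>I. d i \<in> R)"
        using hI sum[of c] by (intro exI[of _ "\<lambda>i. c (h i)"]) simp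
    qed
    finally show ?thesis .
  qed
  ultimately show ?thesis
    unfolding basis_over_def by blast
qed

text \<open>\<open>M\<close> is the direct sum of \<open>K\<close> and the multiples of
  \<open>H\<close>: \<open>split\<close> yields the decomposition, and \<open>direct\<close> forces
  the coefficient of \<open>H\<close> to vanish in every relation.\<close>

lemma basis_over_insert:
  fixes R M :: "'a::comm_ring_1 set"
  assumes basis: "basis_over R K J b" and s: "s \<notin> J"
    and minus: "\<And>x. x \<in> R \<Longrightarrow> - x \<in> R"
    and M: "K \<subseteq> M" "H \<in> M" "\<And>x y. x \<in> M \<Longrightarrow> y \<in> M \<Longrightarrow> x + y \<in> M" "\<And>r x. r \<in> R \<Longrightarrow> x \<in> M \<Longrightarrow> r * x \<in> M"
    and split: "\<And>x. x \<in> M \<Longrightarrow> \<exists>r\<in>R. x - r * H \<in> K"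
    and direct: "\<And>r. r \<in> R \<Longrightarrow> r * H \<in> K \<Longrightarrow> r = 0"
  shows "basis_over R M (insert s J) (b(s := H))"
proof -
  have fin: "finite J" and K: "K = {\<Sum>j\<in>J. c j * b j |c. \<forall>j\<in>J. c j \<in> R}"
    and indep: "\<And>c. \<forall>j\<in>J. c j \<in> R \<Longrightarrow> (\<Sum>j\<in>J. c j * b j) = 0 \<Longrightarrow> \<forall>j\<in>J. c j = 0"
    using basis unfolding basis_over_def by blast+
  have sum: "(\<Sum>j\<in>insert s J. c j * (b(s := H)) j) = c s * H + (\<Sum>j\<in>J. c j * b j)" for c
  proof -
    have "(\<Sum>j\<in>J. c j * (b(s := H)) j) = (\<Sum>j\<in>J. c j * b j)"
      using s by (intro sum.cong) auto
    then show ?thesis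
      using fin s by simp
  qed
  have "\<forall>j\<in>insert s J. c j = 0"
    if c: "\<forall>j\<in>insert s J. c j \<in> R" and 0: "(\<Sum>j\<in>insert s J. c j * (b(s := H)) j) = 0" for c
  proof -
    have eq: "c s * H + (\<Sum>j\<in>J. c j * b j) = 0"
      using 0 by (simp only: sum)
    then have "- c s * H = (\<Sum>j\<in>J. c j * b j)"
      by (simp add: add_eq_0_iff)
    then have "- c s * H \<in> K"
      unfolding K using c by blast
    \<comment> \<open>Moving the other terms across produces the coefficient \<open>- c s\<close>,
      hence the closure of \<open>R\<close> under negation.\<close>
    with direct[of "- c s"] minus c have "c s = 0"
      by simp
    moreover from this have "\<forall>j\<in>J. c j = 0"
      using eq c by (intro indep) simp_all
    ultimately show ?thesis
      by blast
  qed
  moreover have "M = {\<Sum>j\<in>insert s J. c j * (b(s := H)) j |c. \<forall>j\<in>insert s J. c j \<in> R}" (is "_ = ?S")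
  proof (intro equalityI subsetI)
    fix x assume "x \<in> M"
    then obtain r where r: "r \<in> R" "x - r * H \<in> K"
      using split by blast
    then obtain c where c: "x - r * H = (\<Sum>j\<in>J. c j * b j)" "\<forall>j\<in>J. c j \<in> R"
      unfolding K by blast
    have "(\<Sum>j\<in>J. (c(s := r)) j * b j) = (\<Sum>j\<in>J. c j * b j)"
      using s by (intro sum.cong) auto
    then have "x = (\<Sum>j\<in>insert s J. (c(s := r)) j * (b(s := H)) j)"
      unfolding sum using c(1) by (simp add: algebra_simps)
    moreover have "\<forall>j\<in>insert s J. (c(s := r)) j \<in> R"
      using c(2) r(1) by simp
    ultimately show "x \<in> ?S"
      by blast
  next
    fix x assume "x \<in> ?S"
    then obtain c where c: "x = c s * H + (\<Sum>j\<in>J. c j * b j)" "\<forall>j\<in>insert s J. c j \<in> R"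
      unfolding sum by blast
    have "(\<Sum>j\<in>J. c j * b j) \<in> K"
      unfolding K using c(2) by blast
    then show "x \<in> M"
      unfolding c(1) using c(2) M by blast
  qed
  ultimately show ?thesis
    unfolding basis_over_def using fin by blast
qed

text \<open>Since \<open>v i\<close> is a unit, the equation can be solved for \<open>f i\<close>,
  and the other coordinates are free. The vector attached to \<open>j\<close> is a solution
  supported on \<open>i\<close> and \<open>j\<close>, with the unit \<open>- v i\<close> at
  \<open>j\<close>.\<close>

lemma basis_over_hyperplane:
  fixes R M :: "'a::comm_ring_1 set"
  assumes R: "0 \<in> R" "\<And>x y. x \<in> R \<Longrightarrow> y \<in> R \<Longrightarrow> x + y \<in> R"
      "\<And>x y. x \<in> R \<Longrightarrow> y \<in> R \<Longrightarrow> x * y \<in> R" "\<And>x. x \<in> R \<Longrightarrow> - x \<in> R"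
    and basis: "basis_over R M I e" and i: "i \<in> I"
    and v: "\<And>j. j \<in> I \<Longrightarrow> v j \<in> R" and inv: "invertible_in R (v i)"
  shows "basis_over R {\<Sum>j\<in>I. f j * e j |f. (\<forall>j\<in>I. f j \<in> R) \<and> (\<Sum>j\<in>I. v j * f j) = 0}
    (I - {i}) (\<lambda>j. v j * e i - v i * e j)"
proof -
  have fin: "finite I" and indep: "\<And>c. \<forall>j\<in>I. c j \<in> R \<Longrightarrow> (\<Sum>j\<in>I. c j * e j) = 0 \<Longrightarrow> \<forall>j\<in>I. c j = 0"
    using basis unfolding basis_over_def by blast+
  obtain y where y: "y \<in> R" "v i * y = 1"
    using inv by (auto simp: invertible_in_def)
  \<comment> \<open>The coordinates, in the basis \<open>e\<close>, of the combination of the new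
    vectors with coefficients \<open>c\<close>.\<close>
  define f where "f c j = (if j = i then \<Sum>k\<in>I - {i}. c k * v k else - (c j * v i))" for c j
  have f_R: "f c j \<in> R" if "\<forall>j\<in>I - {i}. c j \<in> R" "j \<in> I" for c j
  proof -
    \<comment> \<open>Stated for all subsets so that finite induction applies.\<close>
    have "(\<Sum>k\<in>S. c k * v k) \<in> R" if "S \<subseteq> I - {i}" for S
      using finite_subset[OF that finite_Diff[OF fin]] that \<open>\<forall>j\<in>I - {i}. c j \<in> R\<close>
      by (induction rule: finite_induct) (auto intro!: R v)
    with that i show ?thesis
      by (auto simp: f_def intro!: R v)
  qed
  \<comment> \<open>Kept general in \<open>g\<close>: taking \<open>e\<close> yields the combination
    itself, taking \<open>v\<close> shows that it satisfies the equation.\<close>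
  have split: "(\<Sum>j\<in>I. f c j * g j) = (\<Sum>j\<in>I - {i}. c j * v j) * g i - (\<Sum>j\<in>I - {i}. c j * v i * g j)" for c g
  proof -
    have "(\<Sum>j\<in>I - {i}. f c j * g j) = (\<Sum>j\<in>I - {i}. - (c j * v i * g j))"
      by (rule sum.cong) (auto simp: f_def)
    then show ?thesis
      by (simp add: sum.remove[OF fin i] f_def sum_negf)
  qed
  have sum: "(\<Sum>j\<in>I - {i}. c j * (v j * e i - v i * e j)) = (\<Sum>j\<in>I. f c j * e j)" for c
    unfolding split by (simp add: right_diff_distrib sum_subtractf sum_distrib_right mult.assoc)
  have ker: "(\<Sum>j\<in>I. v j * f c j) = 0" for c
    using split[of c v] by (simp add: sum_distrib_left sum_distrib_right mult_ac)
  have indep': "\<forall>j\<in>I - {i}. c j = 0"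
    if c: "\<forall>j\<in>I - {i}. c j \<in> R" and 0: "(\<Sum>j\<in>I - {i}. c j * (v j * e i - v i * e j)) = 0" for c
  proof
    fix j assume j: "j \<in> I - {i}"
    have "f c j = 0"
      using indep[of "f c"] f_R[OF c] 0 j unfolding sum by blast
    with j have "c j * v i * y = 0"
      by (simp add: f_def)
    then show "c j = 0"
      using y(2) by (simp add: mult.assoc)
  qed
  have span: "\<exists>c. (\<Sum>j\<in>I. g j * e j) = (\<Sum>j\<in>I - {i}. c j * (v j * e i - v i * e j)) \<and> (\<forall>j\<in>I - {i}. c j \<in> R)"
    if g: "\<forall>j\<in>I. g j \<in> R" "(\<Sum>j\<in>I. v j * g j) = 0" for g
  proof (intro exI conjI)
    \<comment> \<open>Forced by comparing coordinates at \<open>j\<close>, where the combination has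
      \<open>- (c j * v i)\<close>. The coordinate at \<open>i\<close> then agrees because
      \<open>g\<close> satisfies the equation.\<close>
    let ?c = "\<lambda>j. - (y * g j)"
    have "v i * g i + (\<Sum>k\<in>I - {i}. v k * g k) = 0"
      using g(2) by (simp add: sum.remove[OF fin i])
    then have "(\<Sum>k\<in>I - {i}. v k * g k) = - (v i * g i)"
      by (simp add: add_eq_0_iff)
    moreover have "(\<Sum>k\<in>I - {i}. ?c k * v k) = - (y * (\<Sum>k\<in>I - {i}. v k * g k))"
      by (simp add: sum_distrib_left sum_negf mult_ac)
    ultimately have "f ?c i = v i * y * g i"
      by (simp add: f_def mult_ac)
    then have "f ?c i = g i"
      by (simp add: y(2))
    moreover have "f ?c j = g j" if "j \<noteq> i" for j
    proof -
      have "f ?c j = v i * y * g j"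
        using that by (simp add: f_def mult_ac)
      then show ?thesis
        by (simp add: y(2))
    qed
    ultimately have "f ?c j = g j" for j
      by (cases "j = i") auto
    then show "(\<Sum>j\<in>I. g j * e j) = (\<Sum>j\<in>I - {i}. ?c j * (v j * e i - v i * e j))"
      unfolding sum by simp
    show "\<forall>j\<in>I - {i}. ?c j \<in> R"
      using g(1) y(1) R by blast
  qed
  have sub: "\<exists>g. (\<Sum>j\<in>I - {i}. c j * (v j * e i - v i * e j)) = (\<Sum>j\<in>I. g j * e j) \<and>
      (\<forall>j\<in>I. g j \<in> R) \<and> (\<Sum>j\<in>I. v j * g j) = 0" if "\<forall>j\<in>I - {i}. c j \<in> R" for c
    using sum[of c] ker[of c] f_R[OF that] by blast
  have "{\<Sum>j\<in>I. f j * e j |f. (\<forall>j\<in>I. f j \<in> R) \<and> (\<Sum>j\<in>I. v j * f j) = 0} =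
    {\<Sum>j\<in>I - {i}. c j * (v j * e i - v i * e j) |c. \<forall>j\<in>I - {i}. c j \<in> R}"
    by (intro equalityI subsetI; clarify) (rule span sub; assumption)+
  with indep' fin show ?thesis
    unfolding basis_over_def by simp
qed

section \<open>The kernel and its complement\<close>

theorem corollary4p5:
  fixes U :: "('d::finite) torus \<Rightarrow> complex"
    and u :: "int ^ 'd \<Rightarrow> 'd torus \<Rightarrow> complex"
    and i :: "int ^ 'd"
  assumes "U \<in> laurent_poly"
    and "\<And>j. j \<in> cube \<Longrightarrow> u j \<in> laurent_poly_down"
    and "U = (\<Sum>j\<in>cube. u j * zpow j)"
    and "i \<in> cube - {0}"
    and "u i \<noteq> 0"
    and "invertible_in laurent_l1_down (u i)"
  shows "basis_over laurent_l1_down (Ker_rho_U U) (cube - {i}) (\<lambda>j. H_gen i u (vabs (j - i)))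
    \<and> (\<forall>H \<in> laurent_poly. invertible_in laurent_l1_down (rho_U U H) \<longrightarrow>
         (\<forall>s \<in> cube - {0}. H_gen i u s \<in> laurent_poly) \<and>
         basis_over laurent_l1_down laurent_l1 (cube :: (int ^ 'd) set) ((H_gen i u)(0 := H)))"
proof -
  have i: "i \<in> cube"
    using assms(4) by blast
  have u: "u j \<in> laurent_l1_down" if "j \<in> cube" for j
    using assms(2)[OF that] laurent_poly_down_subset_l1 by blast
  have U: "U \<in> laurent_l1"
    using assms(1) laurent_poly_subset_l1 by blast
  have conj_u: "laurent_conj (u j) = conj_fun (u j)" if "j \<in> cube" for j
    using u[OF that] laurent_l1_down_subset by (intro laurent_conj_eq) blast
  have H_gen: "H_gen i u (vabs (j - i)) = conj_fun (u j) * zpow i - conj_fun (u i) * zpow j"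
    if "j \<in> cube - {i}" for j
    using that i by (simp add: H_gen_vabs conj_u)
  have rho_U: "rho_U U F = avg (U * conj_fun F)" if "F \<in> laurent_l1" for F
    using U that by (rule rho_U_eq_avg)
  have "rho_U U (\<Sum>j\<in>cube. f j * zpow j) = conj_fun (\<Sum>j\<in>cube. conj_fun (u j) * f j)"
    if "\<forall>j\<in>cube. f j \<in> laurent_l1_down" for f
    unfolding assms(3) using that by (subst rho_U_expansion) (auto simp: u conj_fun_sum)
  \<comment> \<open>Conjugation vanishes only at 0, so the kernel of the conjugate-linear map is cut
    out by a linear equation with coefficients \<open>conj_fun (u j)\<close>.\<close>
  then have ker: "rho_U U (\<Sum>j\<in>cube. f j * zpow j) = 0 \<longleftrightarrow> (\<Sum>j\<in>cube. conj_fun (u j) * f j) = 0"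
    if "\<forall>j\<in>cube. f j \<in> laurent_l1_down" for f
    using that by simp
  have Ker: "Ker_rho_U U = {\<Sum>j\<in>cube. f j * zpow j |f. (\<forall>j\<in>cube. f j \<in> laurent_l1_down) \<and>
      (\<Sum>j\<in>cube. conj_fun (u j) * f j) = 0}" (is "_ = ?S")
  proof (intro equalityI subsetI)
    fix F assume "F \<in> Ker_rho_U U"
    then have F: "F \<in> laurent_l1" "rho_U U F = 0"
      by (auto simp: Ker_rho_U_def)
    obtain f where f: "\<And>j. j \<in> cube \<Longrightarrow> f j \<in> laurent_l1_down" "F = (\<Sum>j\<in>cube. f j * zpow j)"
      using laurent_l1_expansion[OF F(1)] by blast
    with F(2) ker[of f] show "F \<in> ?S"
      by blast
  next
    fix F assume "F \<in> ?S"
    then obtain f where f: "\<forall>j\<in>cube. f j \<in> laurent_l1_down" "F = (\<Sum>j\<in>cube. f j * zpow j)"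
      "(\<Sum>j\<in>cube. conj_fun (u j) * f j) = 0"
      by blast
    then show "F \<in> Ker_rho_U U"
      using ker[OF f(1)] expansion_in_l1[of f] by (simp add: Ker_rho_U_def)
  qed
  obtain y where y: "y \<in> laurent_l1_down" "u i * y = 1"
    using assms(6) by (auto simp: invertible_in_def)
  \<comment> \<open>Conjugation carries units to units, so the hyperplane equation has a unit
    coefficient at \<open>i\<close>.\<close>
  have "conj_fun (u i) * conj_fun y = 1"
    using arg_cong[OF y(2), of conj_fun] by simp
  then have "invertible_in laurent_l1_down (conj_fun (u i))"
    unfolding invertible_in_def using laurent_l1_down_conj y(1) u[OF i] by blast
  then have "basis_over laurent_l1_down (Ker_rho_U U) (cube - {i})
      (\<lambda>j. conj_fun (u j) * zpow i - conj_fun (u i) * zpow j)"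
    unfolding Ker
    by (intro basis_over_hyperplane[where M = laurent_l1] basis_over_zpow i laurent_l1_down_0
        laurent_l1_down_add laurent_l1_down_mult laurent_l1_down_minus laurent_l1_down_conj u)
  then have basis: "basis_over laurent_l1_down (Ker_rho_U U) (cube - {i}) (\<lambda>j. H_gen i u (vabs (j - i)))"
    by (subst basis_over_cong[OF H_gen])
  have bij: "bij_betw (\<lambda>j. vabs (j - i)) (cube - {i}) (cube - {0})"
    by (rule bij_betw_vabs_cube[OF i])
  have poly: "H_gen i u s \<in> laurent_poly" if "s \<in> cube - {0}" for s
  proof -
    \<comment> \<open>\<open>H_gen\<close> has an explicit form only at indices
      \<open>|j - i|\<close>; surjectivity of the bijection covers every \<open>s\<close>.\<close>
    have "s \<in> (\<lambda>j. vabs (j - i)) ` (cube - {i})"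
      unfolding bij_betw_imp_surj_on[OF bij] by (rule that)
    then obtain j where j: "j \<in> cube - {i}" "s = vabs (j - i)"
      by (elim imageE)
    have "conj_fun (u k) \<in> laurent_poly" if "k \<in> cube" for k
      using assms(2)[OF that] laurent_poly_down_subset by (intro laurent_poly_conj) blast
    then show ?thesis
      unfolding j(2) H_gen[OF j(1)] using i j(1)
      by (intro laurent_poly_diff laurent_poly_mult laurent_poly_zpow) auto
  qed
  have "basis_over laurent_l1_down laurent_l1 cube ((H_gen i u)(0 := H))"
    if "H \<in> laurent_poly" and inv: "invertible_in laurent_l1_down (rho_U U H)" for H
  proof -
    have H: "H \<in> laurent_l1"
      using that laurent_poly_subset_l1 by blast
    obtain w where w: "w \<in> laurent_l1_down" "rho_U U H * w = 1"
      using inv by (auto simp: invertible_in_def)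
    have mult: "r * F \<in> laurent_l1" if "r \<in> laurent_l1_down" "F \<in> laurent_l1"
      for r F :: "'d torus \<Rightarrow> complex"
      using that laurent_l1_down_subset by (blast intro: laurent_l1_mult)
    have rho_mult: "rho_U U (r * F) = conj_fun r * rho_U U F"
      if "r \<in> laurent_l1_down" "F \<in> laurent_l1" for r F
    proof -
      have "U * conj_fun (r * F) = conj_fun r * (U * conj_fun F)"
        by (simp add: mult_ac)
      then show ?thesis
        using that by (simp only: rho_U mult avg_mult_down laurent_l1_down_conj)
    qed
    \<comment> \<open>The reindexed kernel basis occupies the nonzero indices, leaving the slot 0
      for \<open>H\<close>.\<close>
    have "basis_over laurent_l1_down laurent_l1 (insert 0 (cube - {0})) ((H_gen i u)(0 := H))"
    proof (rule basis_over_insert[OF basis_over_reindex[OF bij basis]])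
      fix F :: "'d torus \<Rightarrow> complex" assume F: "F \<in> laurent_l1"
      \<comment> \<open>Chosen so that \<open>rho_U U (r * H) = rho_U U F\<close>: \<open>w\<close>
        inverts \<open>rho_U U H\<close>, and the conjugate compensates for
        conjugate-linearity.\<close>
      define r where "r = conj_fun (rho_U U F * w)"
      have r: "r \<in> laurent_l1_down"
        unfolding r_def rho_U[OF F]
        by (intro laurent_l1_down_conj laurent_l1_down_mult avg_in_down laurent_l1_mult laurent_l1_conj U F w)
      have G: "F - r * H \<in> laurent_l1"
        using laurent_l1_add[OF F laurent_l1_minus[OF mult[OF r H]]] by simp
      have "F = (F - r * H) + r * H"
        by simp
      then have "U * conj_fun F = U * conj_fun (F - r * H) + U * conj_fun (r * H)"
        by (metis conj_fun_simps(1) distrib_left)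
      then have "rho_U U F = rho_U U (F - r * H) + rho_U U (r * H)"
        by (simp only: rho_U F G mult r H avg_add)
      also have "rho_U U (r * H) = rho_U U F * (rho_U U H * w)"
        unfolding rho_mult[OF r H] by (simp add: r_def mult_ac)
      finally have "rho_U U (F - r * H) = 0"
        by (simp only: w(2) mult_1_right add_cancel_right_left)
      with r G show "\<exists>r\<in>laurent_l1_down. F - r * H \<in> Ker_rho_U U"
        unfolding Ker_rho_U_def by blast
    next
      fix r :: "'d torus \<Rightarrow> complex" assume r: "r \<in> laurent_l1_down" "r * H \<in> Ker_rho_U U"
      \<comment> \<open>Multiplying by \<open>w\<close> cancels the unit \<open>rho_U U H\<close>
        and leaves \<open>conj_fun r = 0\<close>.\<close>
      then have "conj_fun r * rho_U U H * w = 0"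
        by (simp add: Ker_rho_U_def rho_mult[OF r(1) H])
      then show "r = 0"
        by (simp add: mult.assoc w(2))
    qed (auto simp: Ker_rho_U_def intro: laurent_l1_down_minus laurent_l1_add mult H)
    then show ?thesis
      by (simp add: insert_absorb)
  qed
  with basis poly show ?thesis
    by blast
qed

end
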